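(* The multi-cuts decomposition (MCD) algorithm described in the context, run on the action selection problem $$\max_{a\in\mathbb{A}}\; r_t(x_t,a)+\gamma v(a)+\gamma w_0,$$ yields a globally optimal solution in a finite number of iterations. That is, run with no cap on the number of iterations and stopped as soon as $V_{\mathrm{ub}}-V_{\mathrm{lb}}\le 0$, the algorithm stops after finitely many iterations, and its output $a^*$ is a globally optimal solution of this problem.
   Context: Data. $\mathbb{A}\subset\times_{n=1}^{N_2}[0,\bar a_n]\subset\mathbb{R}^{N_2}$ is a finite nonempty action set; $x_t\in\mathbb{X}\subset\mathbb{R}^{N_1}$ is a fixed state; $r_t(x_t,\cdot):\mathbb{A}\to\mathbb{R}$ is the reward; $\gamma\in(0,1)$. Given samples $\xi^s$, $s\in\mathcal{S}_2=\{1,\dots,S_2\}$, the next state under action $a$ is $f(x_t,a,\xi^s)=A^s+B^sa$ with $A^s=A(x_t,\xi^s)\in\mathbb{R}^{N_1}$, $B^s=B(x_t,\xi^s)\in\mathbb{R}^{N_1\times N_2}$. A trained two-layer ReLU network has weights $w_0,w_j,u_{0j}\in\mathbb{R}$, $u_j\in\mathbb{R}^{N_1}$, $j\in\mathcal{J}=\{1,\dots,J\}$. The recourse function is $$v(a)=\frac1{S_2}\sum_{s\in\mathcal{S}_2}\sum_{j\in\mathcal{J}}w_j\max\{u_j^\top(A^s+B^sa)+u_{0j},0\}.$$ Let $\mathcal{J}^+=\{j:w_j>0\}$ and $\mathcal{J}^-=\{j:w_j\le0\}$. Let $\bar\eta$ be an upper bound of $v$ on $\mathbb{A}$. Cuts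 generated at an action $a^m\in\mathbb{A}$: (a) Integer optimality cut: $\eta\le v(a^m)+\zeta^m(a)[\bar\eta-v(a^m)]$, where $\zeta^m:\mathbb{A}\to\mathbb{R}$ satisfies $\zeta^m(a)=0$ if $a=a^m$ and $\zeta^m(a)\ge1$ otherwise. (b) Valid cut: $$\eta\le\frac1{S_2}\sum_{s\in\mathcal{S}_2}\Big[\sum_{j\in\mathcal{J}^-}\big((\phi_j^{ms})^\top a+\phi_{0j}^{ms}\big)+\sum_{j\in\mathcal{J}^+}\Big(\sum_{n=1}^{N_2}\theta_{nj}^sa_n+\theta_{0j}^s\Big)\Big].$$ Here, with $\mathbb{I}(z)=1$ if $z>0$ and $0$ otherwise, and $I_j^{ms}=\mathbb{I}(u_j^\top(A^s+B^sa^m)+u_{0j})$: $\phi_j^{ms}=w_jI_j^{ms}(B^s)^\top u_j\in\mathbb{R}^{N_2}$ and $\phi_{0j}^{ms}=w_jI_j^{ms}(u_j^\top A^s+u_{0j})$. Further, with $\Gamma^{(1)}_{njs}=[u_j^\top B^s]_n$, $\Gamma^{(2)}_{js}=u_j^\top A^s+u_{0j}$, $\mathbf{N}^+_{js}=\{n:\Gamma^{(1)}_{njs}\ge0\}$, $\mathbf{N}^-_{js}=\{n:\Gamma^{(1)}_{njs}<0\}$, $M^{\pm}_{js}=\sum_{n\in\mathbf{N}^{\pm}_{js}}\Gamma^{(1)}_{njs}\bar a_n+\Gamma^{(2)}_{js}$ and $\vartheta_j^s=M^+_{js}/\sum_{n=1}^{N_2}|\Gamma^{(1)}_{njs}|\bar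 a_n$ (with $\vartheta_j^s:=0$ if this denominator is $0$): - if $M^-_{js}>0$: $\theta_{nj}^s=w_j\Gamma^{(1)}_{njs}$ and $\theta_{0j}^s=w_j\Gamma^{(2)}_{js}$; - if $M^+_{js}<0$: $\theta_{nj}^s=0$ and $\theta_{0j}^s=0$; - otherwise: $\theta_{nj}^s=w_j\Gamma^{(1)}_{njs}\vartheta_j^s$ and $\theta_{0j}^s=-w_j\sum_{n\in\mathbf{N}^-_{js}}\vartheta_j^s\Gamma^{(1)}_{njs}\bar a_n$. MCD algorithm. Start with an initial solution $a^1\in\mathbb{A}$, $m=1$, $V_{\mathrm{lb}}=-\infty$, $V_{\mathrm{ub}}=+\infty$. In iteration $m$: 1. compute $V^m=r_t(x_t,a^m)+\gamma v(a^m)+\gamma w_0$ and set $V_{\mathrm{lb}}\leftarrow\max\{V^m,V_{\mathrm{lb}}\}$; 2. construct cuts (a) and (b) at $a^m$; 3. solve the first-stage problem $\max_{a\in\mathbb{A},\eta\in\mathbb{R}}r_t(x_t,a)+\gamma\eta+\gamma w_0$ subject to cuts (a) and (b) for all $m'=1,\dots,m$; let $V_{\mathrm{ub}}$ be its optimal value and $a^{m+1}$ the action component of an optimal solution; 4. test the stopping criterion; if it is not met, set $m\leftarrow m+1$ and repeat. On stopping, output $a^*\in\arg\max\{r_t(x_t,a)+\gamma v(a)+\gamma w_0: a\in\{a^1,\dots,a^m\}\}$. *)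

theory Defs
  imports "HOL-Analysis.Analysis"
begin

text \<open>
  The dimensions \<open>N\<^sub>1\<close> (state) and \<open>N\<^sub>2\<close> (action) are the cardinalities of the finite index
  types \<open>'n1\<close> and \<open>'n2\<close>. The fields \<open>samp\<close>, \<open>w\<close>, \<open>u\<close>, \<open>u0\<close> are only meaningful on the index
  sets \<open>{1..S2}\<close> and \<open>{1..J}\<close>; \<open>reward\<close> is the reward function at the fixed stage, with its
  state argument explicit.
\<close>

record ('n1::finite, 'n2::finite, 'xi) mcd_data =
  Act :: "(real^'n2) set"
  abar :: "real^'n2"
  X :: "(real^'n1) set"
  xt :: "real^'n1"
  reward :: "real^'n1 \<Rightarrow> real^'n2 \<Rightarrow> real"
  disc :: real
  S2 :: nat
  samp :: "nat \<Rightarrow> 'xi"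
  Amap :: "real^'n1 \<Rightarrow> 'xi \<Rightarrow> real^'n1"
  Bmap :: "real^'n1 \<Rightarrow> 'xi \<Rightarrow> real^'n2^'n1"
  J :: nat
  w0 :: real
  w :: "nat \<Rightarrow> real"
  u0 :: "nat \<Rightarrow> real"
  u :: "nat \<Rightarrow> real^'n1"

definition valid_data :: "('n1::finite, 'n2::finite, 'xi) mcd_data \<Rightarrow> bool" where
  "valid_data D \<longleftrightarrow>
     finite (Act D) \<and> Act D \<noteq> {} \<and>
     (\<forall>a\<in>Act D. \<forall>n. 0 \<le> a $ n \<and> a $ n \<le> abar D $ n) \<and>
     xt D \<in> X D \<and> 0 < disc D \<and> disc D < 1 \<and> 1 \<le> S2 D \<and> 1 \<le> J D"

definition Avec :: "('n1::finite, 'n2::finite, 'xi) mcd_data \<Rightarrow> nat \<Rightarrow> real^'n1" where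
  "Avec D s = Amap D (xt D) (samp D s)"

definition Bmat :: "('n1::finite, 'n2::finite, 'xi) mcd_data \<Rightarrow> nat \<Rightarrow> real^'n2^'n1" where
  "Bmat D s = Bmap D (xt D) (samp D s)"

definition next_state :: "('n1::finite, 'n2::finite, 'xi) mcd_data \<Rightarrow> real^'n2 \<Rightarrow> nat \<Rightarrow> real^'n1" where
  "next_state D a s = Avec D s + Bmat D s *v a"

definition preact :: "('n1::finite, 'n2::finite, 'xi) mcd_data \<Rightarrow> nat \<Rightarrow> nat \<Rightarrow> real^'n2 \<Rightarrow> real" where
  "preact D j s a = u D j \<bullet> next_state D a s + u0 D j"

definition recourse :: "('n1::finite, 'n2::finite, 'xi) mcd_data \<Rightarrow> real^'n2 \<Rightarrow> real" where
  "recourse D a =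
     1 / real (S2 D) * (\<Sum>s\<in>{1..S2 D}. \<Sum>j\<in>{1..J D}. w D j * max (preact D j s a) 0)"

definition objective :: "('n1::finite, 'n2::finite, 'xi) mcd_data \<Rightarrow> real^'n2 \<Rightarrow> real" where
  "objective D a = reward D (xt D) a + disc D * recourse D a + disc D * w0 D"

definition globally_optimal :: "('n1::finite, 'n2::finite, 'xi) mcd_data \<Rightarrow> real^'n2 \<Rightarrow> bool" where
  "globally_optimal D a \<longleftrightarrow> is_arg_max (objective D) (\<lambda>b. b \<in> Act D) a"

definition Jplus :: "('n1::finite, 'n2::finite, 'xi) mcd_data \<Rightarrow> nat set" where
  "Jplus D = {j \<in> {1..J D}. w D j > 0}"

definition Jminus :: "('n1::finite, 'n2::finite, 'xi) mcd_data \<Rightarrow> nat set" where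
  "Jminus D = {j \<in> {1..J D}. w D j \<le> 0}"


subsection \<open>Integer optimality cuts\<close>

definition zeta_admissible ::
    "('n1::finite, 'n2::finite, 'xi) mcd_data \<Rightarrow> real^'n2 \<Rightarrow> (real^'n2 \<Rightarrow> real) \<Rightarrow> bool" where
  "zeta_admissible D am z \<longleftrightarrow> (\<forall>a\<in>Act D. if a = am then z a = 0 else z a \<ge> 1)"

text \<open>A cut is represented by the function \<open>g\<close> of its constraint \<open>\<eta> \<le> g a\<close>.\<close>

definition integer_cut ::
    "('n1::finite, 'n2::finite, 'xi) mcd_data \<Rightarrow> real \<Rightarrow> (real^'n2 \<Rightarrow> real) \<Rightarrow> real^'n2 \<Rightarrow> real^'n2 \<Rightarrow> real" where
  "integer_cut D etabar z am a = recourse D am + z a * (etabar - recourse D am)"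


subsection \<open>Valid cuts\<close>

definition ind :: "real \<Rightarrow> real" where
  "ind z = (if z > 0 then 1 else 0)"

definition phi :: "('n1::finite, 'n2::finite, 'xi) mcd_data \<Rightarrow> real^'n2 \<Rightarrow> nat \<Rightarrow> nat \<Rightarrow> real^'n2" where
  "phi D am j s = (w D j * ind (preact D j s am)) *\<^sub>R (transpose (Bmat D s) *v u D j)"

definition phi0 :: "('n1::finite, 'n2::finite, 'xi) mcd_data \<Rightarrow> real^'n2 \<Rightarrow> nat \<Rightarrow> nat \<Rightarrow> real" where
  "phi0 D am j s = w D j * ind (preact D j s am) * (u D j \<bullet> Avec D s + u0 D j)"

definition Gamma1 :: "('n1::finite, 'n2::finite, 'xi) mcd_data \<Rightarrow> 'n2 \<Rightarrow> nat \<Rightarrow> nat \<Rightarrow> real" where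
  "Gamma1 D n j s = (u D j v* Bmat D s) $ n"

definition Gamma2 :: "('n1::finite, 'n2::finite, 'xi) mcd_data \<Rightarrow> nat \<Rightarrow> nat \<Rightarrow> real" where
  "Gamma2 D j s = u D j \<bullet> Avec D s + u0 D j"

definition Nplus :: "('n1::finite, 'n2::finite, 'xi) mcd_data \<Rightarrow> nat \<Rightarrow> nat \<Rightarrow> 'n2 set" where
  "Nplus D j s = {n. Gamma1 D n j s \<ge> 0}"

definition Nminus :: "('n1::finite, 'n2::finite, 'xi) mcd_data \<Rightarrow> nat \<Rightarrow> nat \<Rightarrow> 'n2 set" where
  "Nminus D j s = {n. Gamma1 D n j s < 0}"

definition Mplus :: "('n1::finite, 'n2::finite, 'xi) mcd_data \<Rightarrow> nat \<Rightarrow> nat \<Rightarrow> real" where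
  "Mplus D j s = (\<Sum>n\<in>Nplus D j s. Gamma1 D n j s * abar D $ n) + Gamma2 D j s"

definition Mminus :: "('n1::finite, 'n2::finite, 'xi) mcd_data \<Rightarrow> nat \<Rightarrow> nat \<Rightarrow> real" where
  "Mminus D j s = (\<Sum>n\<in>Nminus D j s. Gamma1 D n j s * abar D $ n) + Gamma2 D j s"

text \<open>Division by zero gives zero, which is the intended value when the denominator vanishes.\<close>

definition vtheta :: "('n1::finite, 'n2::finite, 'xi) mcd_data \<Rightarrow> nat \<Rightarrow> nat \<Rightarrow> real" where
  "vtheta D j s = Mplus D j s / (\<Sum>n\<in>UNIV. \<bar>Gamma1 D n j s\<bar> * abar D $ n)"

definition theta :: "('n1::finite, 'n2::finite, 'xi) mcd_data \<Rightarrow> 'n2 \<Rightarrow> nat \<Rightarrow> nat \<Rightarrow> real" where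
  "theta D n j s =
     (if Mminus D j s > 0 then w D j * Gamma1 D n j s
      else if Mplus D j s < 0 then 0
      else w D j * Gamma1 D n j s * vtheta D j s)"

definition theta0 :: "('n1::finite, 'n2::finite, 'xi) mcd_data \<Rightarrow> nat \<Rightarrow> nat \<Rightarrow> real" where
  "theta0 D j s =
     (if Mminus D j s > 0 then w D j * Gamma2 D j s
      else if Mplus D j s < 0 then 0
      else - w D j * (\<Sum>n\<in>Nminus D j s. vtheta D j s * Gamma1 D n j s * abar D $ n))"

definition valid_cut :: "('n1::finite, 'n2::finite, 'xi) mcd_data \<Rightarrow> real^'n2 \<Rightarrow> real^'n2 \<Rightarrow> real" where
  "valid_cut D am a =
     1 / real (S2 D) * (\<Sum>s\<in>{1..S2 D}.
        (\<Sum>j\<in>Jminus D. phi D am j s \<bullet> a + phi0 D am j s)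
      + (\<Sum>j\<in>Jplus D. (\<Sum>n\<in>UNIV. theta D n j s * a $ n) + theta0 D j s))"


subsection \<open>The algorithm\<close>

definition master_feasible ::
    "('n1::finite, 'n2::finite, 'xi) mcd_data \<Rightarrow> (real^'n2 \<Rightarrow> real) list \<Rightarrow> (real^'n2) \<times> real \<Rightarrow> bool" where
  "master_feasible D gs = (\<lambda>(a, \<eta>). a \<in> Act D \<and> (\<forall>g\<in>set gs. \<eta> \<le> g a))"

definition master_objective ::
    "('n1::finite, 'n2::finite, 'xi) mcd_data \<Rightarrow> (real^'n2) \<times> real \<Rightarrow> real" where
  "master_objective D = (\<lambda>(a, \<eta>). reward D (xt D) a + disc D * \<eta> + disc D * w0 D)"

text \<open>
  The state after \<open>m\<close> completed iterations: \<open>visited\<close> is \<open>[a\<^sup>1, \<dots>, a\<^sup>m]\<close>, \<open>current\<close> is the action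
  \<open>a\<^sup>m\<^sup>+\<^sup>1\<close> at which the next iteration would start, and \<open>cuts\<close> holds the cuts generated at the
  visited actions.
\<close>

record 'n2 mcd_state =
  visited :: "(real^'n2) list"
  current :: "real^'n2"
  cuts :: "(real^'n2 \<Rightarrow> real) list"
  v_lb :: ereal
  v_ub :: ereal

definition mcd_initial ::
    "('n1::finite, 'n2::finite, 'xi) mcd_data \<Rightarrow> 'n2 mcd_state \<Rightarrow> bool" where
  "mcd_initial D st \<longleftrightarrow>
     (\<exists>a1\<in>Act D. st = \<lparr>visited = [], current = a1, cuts = [], v_lb = -\<infinity>, v_ub = \<infinity>\<rparr>)"

definition mcd_stopped :: "'n2::finite mcd_state \<Rightarrow> bool" where
  "mcd_stopped st \<longleftrightarrow> v_ub st - v_lb st \<le> 0"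

text \<open>
  One full iteration from a state in which the stopping test has not succeeded. \<open>zeta m am\<close> is the
  function used in the integer optimality cut if iteration \<open>m\<close> is at action \<open>am\<close>. The relation is
  nondeterministic: any optimal solution of the first-stage problem may be returned.
\<close>

definition mcd_iteration ::
    "('n1::finite, 'n2::finite, 'xi) mcd_data \<Rightarrow> real \<Rightarrow> (nat \<Rightarrow> real^'n2 \<Rightarrow> real^'n2 \<Rightarrow> real) \<Rightarrow>
     'n2 mcd_state \<Rightarrow> 'n2 mcd_state \<Rightarrow> bool" where
  "mcd_iteration D etabar zeta st st' \<longleftrightarrow>
     \<not> mcd_stopped st \<and>
     (let m = Suc (length (visited st));
          am = current st;
          gs = cuts st @ [integer_cut D etabar (zeta m am) am, valid_cut D am]
      in \<exists>a' \<eta>'. is_arg_max (master_objective D) (master_feasible D gs) (a', \<eta>') \<and>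
           st' = \<lparr>visited = visited st @ [am],
                  current = a',
                  cuts = gs,
                  v_lb = max (ereal (objective D am)) (v_lb st),
                  v_ub = ereal (master_objective D (a', \<eta>'))\<rparr>)"

definition mcd_reachable ::
    "('n1::finite, 'n2::finite, 'xi) mcd_data \<Rightarrow> real \<Rightarrow> (nat \<Rightarrow> real^'n2 \<Rightarrow> real^'n2 \<Rightarrow> real) \<Rightarrow>
     'n2 mcd_state \<Rightarrow> bool" where
  "mcd_reachable D etabar zeta st \<longleftrightarrow>
     (\<exists>st0. mcd_initial D st0 \<and> (mcd_iteration D etabar zeta)\<^sup>*\<^sup>* st0 st)"

definition mcd_output ::
    "('n1::finite, 'n2::finite, 'xi) mcd_data \<Rightarrow> 'n2 mcd_state \<Rightarrow> real^'n2 \<Rightarrow> bool" where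
  "mcd_output D st a \<longleftrightarrow> is_arg_max (objective D) (\<lambda>b. b \<in> set (visited st)) a"

end

theory Submission
  imports Defs
begin

text \<open>
  Both kinds of cut bound the recourse function from above on the action set: for the valid cut, a
  negatively weighted ReLU lies below any of its two linear pieces, and a positively weighted one
  lies below the chord of the ReLU over the interval \<open>[M\<^sup>-, M\<^sup>+]\<close> of possible preactivations. Hence
  \<open>V\<^sub>u\<^sub>b\<close> never drops below the optimal value. The integer cut is tight at the action that generates
  it, so as soon as the first-stage problem returns an action already visited, \<open>V\<^sub>u\<^sub>b \<le> V\<^sub>l\<^sub>b\<close> and the
  algorithm stops; until then the visited actions are distinct elements of the finite action set.
\<close>

section \<open>Upper bounds on the recourse function from both kinds of cut\<close>

lemma relu_le_chord:
  fixes l h y :: real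
  assumes "l \<le> y" "y \<le> h" "l \<le> 0" "0 \<le> h"
  shows "max y 0 \<le> h / (h - l) * (y - l)"
proof (cases "h = l")
  \<comment> \<open>The signs force \<open>l = h = 0\<close>, hence \<open>y = 0\<close>, and the
    slope is \<open>0 / 0 = 0\<close>.\<close>
  case True
  with assms show ?thesis by simp
next
  case False
  with assms have pos: "h - l > 0" by linarith
  \<comment> \<open>This product is exactly the gap
    \<open>h * (y - l) - y * (h - l)\<close>.\<close>
  have "0 \<le> l * (y - h)"
    using assms by (simp add: mult_nonpos_nonpos)
  then have "y * (h - l) \<le> h * (y - l)"
    by (simp add: algebra_simps)
  then have "y \<le> h / (h - l) * (y - l)"
    using pos by (simp add: field_simps)
  moreover have "0 \<le> h / (h - l) * (y - l)"
    using assms pos by simp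
  ultimately show ?thesis by simp
qed

lemma preact_eq_Gamma:
  "preact D j s a = (\<Sum>n\<in>UNIV. Gamma1 D n j s * a $ n) + Gamma2 D j s"
proof -
  have "u D j \<bullet> (Bmat D s *v a) = (u D j v* Bmat D s) \<bullet> a"
    by (rule dot_lmul_matrix[symmetric])
  then show ?thesis
    by (simp add: preact_def next_state_def Gamma1_def Gamma2_def inner_right_distrib
        inner_vec_def[of "u D j v* Bmat D s"])
qed

text \<open>The \<open>phi\<close> term is the linear piece of the ReLU selected by the activation
  pattern at \<open>am\<close>, evaluated at \<open>a\<close>.\<close>

lemma phi_eq_preact:
  "phi D am j s \<bullet> a + phi0 D am j s = w D j * ind (preact D j s am) * preact D j s a"
proof -
  have "(transpose (Bmat D s) *v u D j) \<bullet> a = u D j \<bullet> (Bmat D s *v a)"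
    by (simp add: dot_lmul_matrix)
  then show ?thesis
    by (simp add: phi_def phi0_def preact_def next_state_def inner_right_distrib algebra_simps)
qed

lemma sum_Nplus_Nminus:
  "(\<Sum>n\<in>UNIV. f n) = (\<Sum>n\<in>Nplus D j s. f n) + (\<Sum>n\<in>Nminus D j s. f n)"
proof -
  have "UNIV = Nplus D j s \<union> Nminus D j s" "Nplus D j s \<inter> Nminus D j s = {}"
    by (auto simp: Nplus_def Nminus_def)
  then show ?thesis
    by (metis finite sum.union_disjoint)
qed

text \<open>An affine function on a box is extremal at corners: \<open>Mminus\<close> and
  \<open>Mplus\<close> are its values at the two opposite corners selected by the signs of
  \<open>Gamma1\<close>.\<close>

lemma preact_bounds:
  assumes "\<And>n. 0 \<le> a $ n \<and> a $ n \<le> abar D $ n"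
  shows "Mminus D j s \<le> preact D j s a" "preact D j s a \<le> Mplus D j s"
proof -
  have eq: "preact D j s a = (\<Sum>n\<in>Nplus D j s. Gamma1 D n j s * a $ n)
      + (\<Sum>n\<in>Nminus D j s. Gamma1 D n j s * a $ n) + Gamma2 D j s"
    by (simp add: preact_eq_Gamma sum_Nplus_Nminus[of _ D j s])
  have "0 \<le> (\<Sum>n\<in>Nplus D j s. Gamma1 D n j s * a $ n)"
    using assms by (auto simp: Nplus_def intro!: sum_nonneg)
  moreover have "(\<Sum>n\<in>Nplus D j s. Gamma1 D n j s * a $ n)
      \<le> (\<Sum>n\<in>Nplus D j s. Gamma1 D n j s * abar D $ n)"
    using assms by (auto simp: Nplus_def intro!: sum_mono mult_left_mono)
  moreover have "(\<Sum>n\<in>Nminus D j s. Gamma1 D n j s * a $ n) \<le> 0"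
    using assms by (auto simp: Nminus_def mult_nonpos_nonneg intro!: sum_nonpos)
  moreover have "(\<Sum>n\<in>Nminus D j s. Gamma1 D n j s * abar D $ n)
      \<le> (\<Sum>n\<in>Nminus D j s. Gamma1 D n j s * a $ n)"
    using assms by (auto simp: Nminus_def intro!: sum_mono mult_left_mono_neg)
  ultimately show "Mminus D j s \<le> preact D j s a" "preact D j s a \<le> Mplus D j s"
    unfolding eq Mminus_def Mplus_def by linarith+
qed

text \<open>Splitting by sign turns the denominator into the length of the preactivation interval,
  which exhibits \<open>vtheta\<close> as the chord slope of \<open>relu_le_chord\<close>. The two
  denominators are equal, so the identity also covers the case where they vanish.\<close>

lemma vtheta_eq: "vtheta D j s = Mplus D j s / (Mplus D j s - Mminus D j s)"
proof -
  have "(\<Sum>n\<in>Nplus D j s. \<bar>Gamma1 D n j s\<bar> * abar D $ n)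
      = (\<Sum>n\<in>Nplus D j s. Gamma1 D n j s * abar D $ n)"
    by (rule sum.cong) (auto simp: Nplus_def)
  moreover have "(\<Sum>n\<in>Nminus D j s. \<bar>Gamma1 D n j s\<bar> * abar D $ n)
      = - (\<Sum>n\<in>Nminus D j s. Gamma1 D n j s * abar D $ n)"
    unfolding sum_negf[symmetric] by (rule sum.cong) (auto simp: Nminus_def)
  ultimately have "(\<Sum>n\<in>UNIV. \<bar>Gamma1 D n j s\<bar> * abar D $ n) = Mplus D j s - Mminus D j s"
    by (simp add: sum_Nplus_Nminus[of _ D j s] Mplus_def Mminus_def)
  then show ?thesis by (simp add: vtheta_def)
qed

text \<open>The cases locate the preactivation interval relative to the kink at 0: to its right the
  ReLU is the identity, to its left it is zero, and otherwise the chord bounds it.\<close>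

lemma relu_le_theta:
  assumes box: "\<And>n. 0 \<le> a $ n \<and> a $ n \<le> abar D $ n" and w: "w D j > 0"
  shows "w D j * max (preact D j s a) 0 \<le> (\<Sum>n\<in>UNIV. theta D n j s * a $ n) + theta0 D j s"
proof -
  note bounds = preact_bounds[OF box, of j s]
  consider "Mminus D j s > 0" | "\<not> Mminus D j s > 0" "Mplus D j s < 0"
    | "\<not> Mminus D j s > 0" "\<not> Mplus D j s < 0" by blast
  then show ?thesis
  proof cases
    case 1
    then have "(\<Sum>n\<in>UNIV. theta D n j s * a $ n) + theta0 D j s = w D j * preact D j s a"
      by (simp add: theta_def theta0_def preact_eq_Gamma distrib_left sum_distrib_left mult.assoc)
    with 1 bounds show ?thesis by simp
  next
    case 2
    with bounds show ?thesis by (simp add: theta_def theta0_def)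
  next
    case 3
    then have "(\<Sum>n\<in>UNIV. theta D n j s * a $ n) + theta0 D j s
        = w D j * (vtheta D j s * ((\<Sum>n\<in>UNIV. Gamma1 D n j s * a $ n)
            - (\<Sum>n\<in>Nminus D j s. Gamma1 D n j s * abar D $ n)))"
      by (simp add: theta_def theta0_def right_diff_distrib sum_distrib_left sum_negf mult_ac)
    \<comment> \<open>\<open>Gamma2\<close> occurs in both the preactivation and
      \<open>Mminus\<close>, so it cancels in their difference.\<close>
    also have "\<dots> = w D j * (vtheta D j s * (preact D j s a - Mminus D j s))"
      by (simp add: preact_eq_Gamma Mminus_def)
    finally have eq: "(\<Sum>n\<in>UNIV. theta D n j s * a $ n) + theta0 D j s
        = w D j * (vtheta D j s * (preact D j s a - Mminus D j s))" .
    have "max (preact D j s a) 0 \<le> vtheta D j s * (preact D j s a - Mminus D j s)"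
      using relu_le_chord[OF bounds] 3 unfolding vtheta_eq by linarith
    then show ?thesis
      using w unfolding eq by (intro mult_left_mono) auto
  qed
qed

lemma recourse_le_valid_cut:
  assumes box: "\<And>n. 0 \<le> a $ n \<and> a $ n \<le> abar D $ n"
  shows "recourse D a \<le> valid_cut D am a"
proof -
  have J: "{1..J D} = Jminus D \<union> Jplus D" "Jminus D \<inter> Jplus D = {}"
    by (auto simp: Jminus_def Jplus_def)
  have fin: "finite (Jminus D)" "finite (Jplus D)"
    by (auto simp: Jminus_def Jplus_def)
  have minus: "w D j * max (preact D j s a) 0 \<le> phi D am j s \<bullet> a + phi0 D am j s"
    if "j \<in> Jminus D" for j s
  proof -
    \<comment> \<open>The left side is one of the two pieces, whatever \<open>am\<close> is; the
      nonpositive weight then reverses the inequality.\<close>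
    have "ind (preact D j s am) * preact D j s a \<le> max (preact D j s a) 0"
      by (simp add: ind_def)
    with that show ?thesis
      by (simp add: phi_eq_preact Jminus_def mult_left_mono_neg mult.assoc)
  qed
  have plus: "w D j * max (preact D j s a) 0
      \<le> (\<Sum>n\<in>UNIV. theta D n j s * a $ n) + theta0 D j s" if "j \<in> Jplus D" for j s
    using that relu_le_theta[OF box] by (simp add: Jplus_def)
  have "(\<Sum>j\<in>{1..J D}. w D j * max (preact D j s a) 0)
      \<le> (\<Sum>j\<in>Jminus D. phi D am j s \<bullet> a + phi0 D am j s)
       + (\<Sum>j\<in>Jplus D. (\<Sum>n\<in>UNIV. theta D n j s * a $ n) + theta0 D j s)" for s
    unfolding J(1) sum.union_disjoint[OF fin J(2)]
    by (intro add_mono sum_mono minus plus)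
  then show ?thesis
    unfolding recourse_def valid_cut_def
    by (intro mult_left_mono sum_mono) auto
qed

text \<open>Away from \<open>am\<close> the factor \<open>z a\<close> is at least 1 and multiplies a
  nonnegative gap, so the cut is no stricter than \<open>\<eta> \<le> etabar\<close>.\<close>

lemma recourse_le_integer_cut:
  assumes "zeta_admissible D am z" "am \<in> Act D" "\<forall>a\<in>Act D. recourse D a \<le> etabar" "a \<in> Act D"
  shows "recourse D a \<le> integer_cut D etabar z am a"
proof (cases "a = am")
  case True
  with assms show ?thesis by (simp add: zeta_admissible_def integer_cut_def)
next
  case False
  with assms have "1 \<le> z a" by (auto simp: zeta_admissible_def)
  then have "1 * (etabar - recourse D am) \<le> z a * (etabar - recourse D am)"
    using assms by (intro mult_right_mono) auto
  with assms show ?thesis by (force simp: integer_cut_def)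
qed

lemma integer_cut_tight:
  assumes "zeta_admissible D am z" "am \<in> Act D"
  shows "integer_cut D etabar z am am = recourse D am"
  using assms by (auto simp: zeta_admissible_def integer_cut_def)

section \<open>Solvability of the first-stage problem\<close>

lemma finite_is_arg_max:
  fixes f :: "'a \<Rightarrow> 'b::linorder"
  assumes "finite S" "S \<noteq> {}"
  shows "\<exists>x. is_arg_max f (\<lambda>x. x \<in> S) x"
proof -
  obtain x where "x \<in> S" "f x = Max (f ` S)"
    using Max_in[of "f ` S"] assms by fastforce
  with assms show ?thesis
    by (auto simp: is_arg_max_linorder)
qed

text \<open>Since \<open>disc D > 0\<close>, the best \<open>\<eta>\<close> for a fixed action is
  the minimum of the cuts there; this reduces the problem to a maximum over the finite action set.
  Without any cut, \<open>\<eta>\<close> would be unbounded.\<close>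

lemma master_optimum_exists:
  assumes D: "valid_data D" and gs: "gs \<noteq> []"
  shows "\<exists>a \<eta>. is_arg_max (master_objective D) (master_feasible D gs) (a, \<eta>)"
proof -
  define h where "h a = Min ((\<lambda>g. g a) ` set gs)" for a
  have h: "\<eta> \<le> h a \<longleftrightarrow> (\<forall>g\<in>set gs. \<eta> \<le> g a)" for \<eta> a
    using gs by (simp add: h_def)
  have "finite (Act D)" "Act D \<noteq> {}" "0 < disc D"
    using D by (auto simp: valid_data_def)
  then obtain a where a: "a \<in> Act D"
    and best: "\<And>b. b \<in> Act D \<Longrightarrow> master_objective D (b, h b) \<le> master_objective D (a, h a)"
    using finite_is_arg_max[of "Act D" "\<lambda>b. master_objective D (b, h b)"]
    by (auto simp: is_arg_max_linorder)
  have "master_objective D (b, \<eta>) \<le> master_objective D (b, h b)" if "\<eta> \<le> h b" for b \<eta>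
    using that \<open>0 < disc D\<close> by (simp add: master_objective_def)
  then have "master_objective D (b, \<eta>) \<le> master_objective D (a, h a)"
    if "master_feasible D gs (b, \<eta>)" for b \<eta>
    using that best[of b] h by (fastforce simp: master_feasible_def)
  moreover have "master_feasible D gs (a, h a)"
    using a h[of "h a" a] by (simp add: master_feasible_def)
  ultimately show ?thesis
    by (auto simp: is_arg_max_linorder)
qed

section \<open>The loop invariant and its preservation\<close>

lemma master_objective_recourse: "master_objective D (a, recourse D a) = objective D a"
  by (simp add: master_objective_def objective_def)

text \<open>The last clause, read contrapositively, makes every further iteration start at a new
  action, which keeps \<open>visited\<close> distinct. The clauses on \<open>v_lb\<close> make it a
  real number attained by a visited action once there is one, so that the extended-real gap can be
  handled.\<close>

definition mcd_invariant :: "('n1::finite, 'n2::finite, 'xi) mcd_data \<Rightarrow> 'n2 mcd_state \<Rightarrow> bool" where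
  "mcd_invariant D st \<longleftrightarrow>
     current st \<in> Act D \<and> set (visited st) \<subseteq> Act D \<and> distinct (visited st) \<and>
     (\<forall>g\<in>set (cuts st). \<forall>a\<in>Act D. recourse D a \<le> g a) \<and>
     (\<forall>a\<in>set (visited st). \<exists>g\<in>set (cuts st). g a = recourse D a) \<and>
     (\<forall>a\<in>set (visited st). ereal (objective D a) \<le> v_lb st) \<and>
     (\<forall>a\<in>Act D. ereal (objective D a) \<le> v_ub st) \<and>
     (visited st = [] \<longrightarrow> v_lb st = -\<infinity> \<and> v_ub st = \<infinity>) \<and>
     (visited st \<noteq> [] \<longrightarrow> (\<exists>b\<in>set (visited st). v_lb st = ereal (objective D b))) \<and>
     (current st \<in> set (visited st) \<longrightarrow> mcd_stopped st)"

lemma mcd_initial_invariant: "mcd_initial D st \<Longrightarrow> mcd_invariant D st"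
  by (auto simp: mcd_initial_def mcd_invariant_def)

lemma mcd_iteration_invariant:
  assumes D: "valid_data D"
    and ub: "\<forall>a\<in>Act D. recourse D a \<le> etabar"
    and zeta: "\<forall>m\<ge>1. \<forall>am\<in>Act D. zeta_admissible D am (zeta m am)"
    and inv: "mcd_invariant D st"
    and step: "mcd_iteration D etabar zeta st st'"
  shows "mcd_invariant D st'"
proof -
  define am where "am = current st"
  define z where "z = zeta (Suc (length (visited st))) am"
  define gs where "gs = cuts st @ [integer_cut D etabar z am, valid_cut D am]"
  from step obtain a' \<eta>' where not_stopped: "\<not> mcd_stopped st"
    and opt: "is_arg_max (master_objective D) (master_feasible D gs) (a', \<eta>')"
    and st': "st' = \<lparr>visited = visited st @ [am], current = a', cuts = gs,
                  v_lb = max (ereal (objective D am)) (v_lb st),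
                  v_ub = ereal (master_objective D (a', \<eta>'))\<rparr>"
    by (auto simp: mcd_iteration_def Let_def gs_def z_def am_def)
  have am: "am \<in> Act D" "am \<notin> set (visited st)" "set (visited st) \<subseteq> Act D" "distinct (visited st)"
    using inv not_stopped by (auto simp: mcd_invariant_def am_def)
  have z: "zeta_admissible D am z"
    using zeta am(1) by (simp add: z_def)
  have box: "0 \<le> a $ n \<and> a $ n \<le> abar D $ n" if "a \<in> Act D" for a n
    using D that by (auto simp: valid_data_def)
  have cuts_valid: "recourse D a \<le> g a" if "g \<in> set gs" "a \<in> Act D" for g a
    using that inv recourse_le_integer_cut[OF z am(1) ub that(2)]
      recourse_le_valid_cut[of a D am] box
    by (auto simp: gs_def mcd_invariant_def)
  have cuts_tight: "\<exists>g\<in>set gs. g a = recourse D a" if "a \<in> set (visited st @ [am])" for a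
    using that inv integer_cut_tight[OF z am(1), of etabar]
    by (auto simp: gs_def mcd_invariant_def)
  have lb: "ereal (objective D a) \<le> v_lb st'" if "a \<in> set (visited st')" for a
    using that inv by (auto simp: st' mcd_invariant_def le_max_iff_disj)
  have lb_attained: "\<exists>b\<in>set (visited st'). v_lb st' = ereal (objective D b)"
  proof (cases "visited st = []")
    case True
    with inv show ?thesis by (simp add: st' mcd_invariant_def)
  next
    case False
    with inv obtain b where "b \<in> set (visited st)" "v_lb st = ereal (objective D b)"
      by (auto simp: mcd_invariant_def)
    then show ?thesis by (auto simp: st' max_def)
  qed
  have ub_valid: "ereal (objective D a) \<le> v_ub st'" if "a \<in> Act D" for a
  proof -
    \<comment> \<open>Every action paired with its true recourse value satisfies all cuts, and its
      first-stage value is its true objective.\<close>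
    have "master_feasible D gs (a, recourse D a)"
      using that cuts_valid by (simp add: master_feasible_def)
    with opt have "master_objective D (a, recourse D a) \<le> master_objective D (a', \<eta>')"
      by (auto simp: is_arg_max_linorder)
    then show ?thesis by (simp add: st' master_objective_recourse)
  qed
  have feas: "a' \<in> Act D" "\<And>g. g \<in> set gs \<Longrightarrow> \<eta>' \<le> g a'"
    using opt by (auto simp: is_arg_max_def master_feasible_def)
  have stop: "mcd_stopped st'" if "a' \<in> set (visited st')"
  proof -
    \<comment> \<open>The tight cut at \<open>a'\<close> is already in \<open>gs\<close>, even if
      \<open>a'\<close> is the action \<open>am\<close> of this very iteration.\<close>
    have "\<eta>' \<le> recourse D a'"
      using cuts_tight[of a'] feas(2) that by (force simp: st')
    then have "master_objective D (a', \<eta>') \<le> objective D a'"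
      using D by (simp add: valid_data_def master_objective_def objective_def)
    then have "v_ub st' \<le> ereal (objective D a')" by (simp add: st')
    also have "\<dots> \<le> v_lb st'" using lb that .
    finally have "v_ub st' \<le> v_lb st'" .
    \<comment> \<open>Finiteness of \<open>v_lb\<close> is what turns the comparison of the bounds
      into a statement about their difference.\<close>
    moreover obtain b where "v_lb st' = ereal (objective D b)"
      using lb_attained by blast
    ultimately show ?thesis by (simp add: mcd_stopped_def st')
  qed
  have fields: "current st' = a'" "visited st' = visited st @ [am]" "cuts st' = gs"
    by (simp_all add: st')
  show ?thesis
    unfolding mcd_invariant_def
    using am feas(1) cuts_valid cuts_tight lb lb_attained ub_valid stop
    by (auto simp: fields)
qed

text \<open>As the iteration relation is nondeterministic, finite termination is expressed over all
  choices of first-stage optima. The progress clause rules out runs that end merely because no step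
  exists.\<close>

theorem theorem2:
  fixes D :: "('n1::finite, 'n2::finite, 'xi) mcd_data"
    and etabar :: real
    and zeta :: "nat \<Rightarrow> real^'n2 \<Rightarrow> real^'n2 \<Rightarrow> real"
  assumes "valid_data D"
    and "\<forall>a\<in>Act D. recourse D a \<le> etabar"
    and "\<forall>m\<ge>1. \<forall>am\<in>Act D. zeta_admissible D am (zeta m am)"
  shows "(\<nexists>run. mcd_initial D (run 0) \<and>
                (\<forall>k::nat. mcd_iteration D etabar zeta (run k) (run (Suc k)))) \<and>
         (\<forall>st. mcd_reachable D etabar zeta st \<and> \<not> mcd_stopped st \<longrightarrow>
                (\<exists>st'. mcd_iteration D etabar zeta st st')) \<and>
         (\<forall>st. mcd_reachable D etabar zeta st \<and> mcd_stopped st \<longrightarrow>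
                (\<exists>a. mcd_output D st a) \<and>
                (\<forall>a. mcd_output D st a \<longrightarrow> globally_optimal D a))"
proof (intro conjI allI impI)
  show "\<nexists>run. mcd_initial D (run 0) \<and>
      (\<forall>k::nat. mcd_iteration D etabar zeta (run k) (run (Suc k)))"
  proof
    assume "\<exists>run. mcd_initial D (run 0) \<and>
      (\<forall>k::nat. mcd_iteration D etabar zeta (run k) (run (Suc k)))"
    then obtain run where init: "mcd_initial D (run 0)"
      and step: "\<And>k. mcd_iteration D etabar zeta (run k) (run (Suc k))" by blast
    have inv: "mcd_invariant D (run k)" for k
      by (induction k) (auto intro: mcd_initial_invariant init mcd_iteration_invariant[OF assms _ step])
    have len: "length (visited (run k)) = k" for k
    proof (induction k)
      case 0
      show ?case using init by (auto simp: mcd_initial_def)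
    next
      case (Suc k)
      with step[of k] show ?case by (auto simp: mcd_iteration_def Let_def)
    qed
    \<comment> \<open>Pigeonhole: this many iterations would visit one more distinct action than
      \<open>Act D\<close> contains.\<close>
    let ?k = "Suc (card (Act D))"
    have "card (set (visited (run ?k))) \<le> card (Act D)"
      using inv[of ?k] assms(1) by (auto simp: mcd_invariant_def valid_data_def intro!: card_mono)
    moreover have "card (set (visited (run ?k))) = ?k"
      using inv[of ?k] len[of ?k] by (simp add: mcd_invariant_def distinct_card)
    ultimately show False by simp
  qed
next
  fix st
  assume "mcd_reachable D etabar zeta st \<and> \<not> mcd_stopped st"
  then show "\<exists>st'. mcd_iteration D etabar zeta st st'"
    using master_optimum_exists[OF assms(1), of "cuts st @ [integer_cut D etabar
      (zeta (Suc (length (visited st))) (current st)) (current st), valid_cut D (current st)]"]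
    by (auto simp: mcd_iteration_def Let_def)
next
  fix st
  assume st: "mcd_reachable D etabar zeta st \<and> mcd_stopped st"
  then obtain st0 where init: "mcd_initial D st0" and "(mcd_iteration D etabar zeta)\<^sup>*\<^sup>* st0 st"
    by (auto simp: mcd_reachable_def)
  from this(2) have inv: "mcd_invariant D st"
    by induction (auto intro: mcd_initial_invariant init mcd_iteration_invariant[OF assms])
  \<comment> \<open>The initial gap is \<open>\<infinity> - (-\<infinity>) = \<infinity>\<close>, so
    the stopping test fails before the first iteration.\<close>
  have nonempty: "visited st \<noteq> []"
    using inv st by (auto simp: mcd_invariant_def mcd_stopped_def)
  then show "\<exists>a. mcd_output D st a"
    unfolding mcd_output_def
    using finite_is_arg_max[of "set (visited st)" "objective D"] by auto
  fix a
  assume "mcd_output D st a"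
  then have a: "a \<in> set (visited st)"
    and best: "\<And>b. b \<in> set (visited st) \<Longrightarrow> objective D b \<le> objective D a"
    by (auto simp: mcd_output_def is_arg_max_linorder)
  obtain b where b: "b \<in> set (visited st)" "v_lb st = ereal (objective D b)"
    using inv nonempty by (auto simp: mcd_invariant_def)
  \<comment> \<open>With \<open>v_lb\<close> real, an infinite \<open>v_ub\<close> would leave a
    positive gap. The output is at least as good as \<open>b\<close>, hence reaches
    \<open>v_ub\<close>, which bounds every objective value.\<close>
  have "v_ub st \<le> ereal (objective D b)"
    using st b(2) by (cases "v_ub st") (auto simp: mcd_stopped_def)
  then have "v_ub st \<le> ereal (objective D a)"
    using best[OF b(1)] by (metis ereal_less_eq(3) order_trans)
  then have "objective D c \<le> objective D a" if "c \<in> Act D" for c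
    using inv that unfolding mcd_invariant_def by (metis ereal_less_eq(3) order_trans)
  moreover have "a \<in> Act D"
    using inv a by (auto simp: mcd_invariant_def)
  ultimately show "globally_optimal D a"
    by (simp add: globally_optimal_def is_arg_max_linorder)
qed

end
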